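(* Let $(X,\mathfrak m)$ be a measure space, let $X_0\subset X$ be measurable, let $\mathcal Q$ be a finite measurable partition of $X_0$ (its members are called atoms), and let $\mathcal B$ be a finite nonempty labelled parent set. For each $B\in\mathcal B$ let $\mathcal T_B$ be a finite labelled child set with measurable shadings $Y(T)\subset X_0$ $(T\in\mathcal T_B)$, and assume $$0<M(Y):=\sum_{B}\sum_{T\in\mathcal T_B}\mathfrak m(Y(T))<\infty,\qquad N_{\max}:=\max_B|\mathcal T_B|<\infty .$$ Put $f_B(x)=\sum_{T\in\mathcal T_B}\mathbf 1_{Y(T)}(x)$. Then there are $k_0\in\{0,\dots,\lceil\log_2 N_{\max}\rceil\}$, with $\mu_{\rm in}:=2^{k_0}$ and restricted shading $$X_{B,k_0}:=\{x:2^{k_0}\le f_B(x)<2^{k_0+1}\},\qquad Y_0(T):=Y(T)\cap X_{B,k_0}\quad(T\in\mathcal T_B),$$ an edge set $E_2\subset\mathcal B\times\mathcal Q$ all of whose edges have positive weight $\omega_{BQ}:=\sum_{T\in\mathcal T_B}\mathfrak m(Y_0(T)\cap Q)>0$, and numbers $\omega_0,d_0>0$ with $\omega_0\le\omega_{BQ}<2\omega_0$ for $(B,Q)\in E_2$, such that, with $$Y_1(T)=Y_0(T)\cap\bigcup_{Q:(B,Q)\in E_2}Q\quad(T\in\mathcal T_B),\qquad Z(B)=\bigcup_{Q:(B,Q)\in E_2}Q,$$ one has $$M(Y_1)\ge L_{\rm at}^{-1}M(Y),\qquad L_{\rm at}\le 4\bigl(1+\lceil\log_2N_{\max}\rceil\bigr)\bigl(1+\lceil\log_2(2e_+)\rceil\bigr)\bigl(1+\lceil\log_2e_+\rceil\bigr),$$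 where $e_+$ is the number of pairs $(B,Q)\in\mathcal B\times\mathcal Q$ with $\omega_{BQ}>0$. Moreover: (A1) $Y_1(T)\subset Z(B)$ for $T\in\mathcal T_B$, and $Z(B)=\bigcup\{Q\in\mathcal Q:\mathfrak m(Q\cap U(\mathcal T_B,Y_1))>0\}$; (A2) on $U(\mathcal T_B,Y_1)$ the multiplicity $\sum_{T\in\mathcal T_B}\mathbf 1_{Y_1(T)}$ lies in $[\mu_{\rm in},2\mu_{\rm in})$; (A3) on $\bigcup_BZ(B)$ the multiplicity $\sum_B\mathbf 1_{Z(B)}$ lies in $[d_0,2d_0)$; (A4) everywhere, $\sum_B\sum_{T\in\mathcal T_B}\mathbf 1_{Y_1(T)}<4\mu_{\rm in}d_0$. Assume additionally that every atom occurring in $E_2$ has measure in $[q_0,\kappa_Qq_0]$ with $q_0>0$. Let $E^{(m)}\subset\cdots\subset E^{(1)}\subset E^{(0)}=E_2$ and define $$Y^{(j)}(T):=Y_0(T)\cap\bigcup_{Q:(B,Q)\in E^{(j)}}Q\quad(T\in\mathcal T_B),\qquad Z^{(j)}(B):=\bigcup_{Q:(B,Q)\in E^{(j)}}Q .$$ Suppose that for $1\le j\le m$, $$\sum_B\mathfrak m(Z^{(j)}(B))\ge c_j\sum_B\mathfrak m(Z^{(j-1)}(B)),\qquad 0<c_j\le1 .$$ Then $$M(Y^{(m)})\ge L_{\rm at}^{-1}\prod_{j=1}^m\frac{c_j}{2\kappa_Q}\;M(Y).$$ At every stage $j$ one still has $\mu_{\rm in}\le\sum_{T\in\mathcal T_B}\mathbf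 1_{Y^{(j)}(T)}<2\mu_{\rm in}$ on $U(\mathcal T_B,Y^{(j)})$ for every $B$, and $\sum_B\sum_{T\in\mathcal T_B}\mathbf 1_{Y^{(j)}(T)}<4\mu_{\rm in}d_0$ everywhere. Finally, a constant parent degree can be restored at any stage by one saturated dyadic right-degree selection: if one chooses a dyadic class $\{Q:d\le\#\{B:(B,Q)\in E^{(j)}\}<2d\}$ carrying the largest number of edges of $E^{(j)}$ and keeps every edge of $E^{(j)}$ at each atom of that class, then the resulting parent multiplicity lies in $[d,2d)$ on its union and the resulting child shading $Y^{\star\star}$ satisfies $M(Y^{\star\star})\ge\frac{1}{2(1+\lceil\log_2|E^{(j)}|\rceil)}M(Y^{(j)})$.
   Context: Labelled families are finite indexed families: distinct labels may have the same geometric realization, and all sums, cardinalities and multiplicities count labels. A shading assigns a measurable set $Y(T)$ to each label $T$. For a labelled family $\mathcal F$ with shading $Y$, $U(\mathcal F,Y)=\bigcup_{F\in\mathcal F}Y(F)$, and $M(\cdot)$ denotes the total labelled mass $\sum_B\sum_{T\in\mathcal T_B}\mathfrak m(\cdot(T))$. Dyadic numbers are powers of two. *)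

theory Defs
  imports "HOL-Analysis.Analysis"
begin

text \<open>
  A parent/child system consists of a finite set of parent labels, child labels
  \<open>Ts B\<close> for each parent \<open>B\<close>, and a shading \<open>Y B T\<close> for \<open>T \<in> Ts B\<close>.
  The shading carries the parent as an argument, so that the same \<open>T\<close> occurring under two
  parents stands for two different child labels.
\<close>

definition family_mult :: "'l set \<Rightarrow> ('l \<Rightarrow> 'x set) \<Rightarrow> 'x \<Rightarrow> nat" where
  "family_mult F Y x = (\<Sum>T\<in>F. indicator (Y T) x)"

definition family_union :: "'l set \<Rightarrow> ('l \<Rightarrow> 'x set) \<Rightarrow> 'x set" where
  "family_union F Y = (\<Union>T\<in>F. Y T)"

definition labelled_mass ::
  "'x measure \<Rightarrow> 'b set \<Rightarrow> ('b \<Rightarrow> 't set) \<Rightarrow> ('b \<Rightarrow> 't \<Rightarrow> 'x set) \<Rightarrow> ennreal" where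
  "labelled_mass M Bs Ts Y = (\<Sum>B\<in>Bs. \<Sum>T\<in>Ts B. emeasure M (Y B T))"

definition total_mult ::
  "'b set \<Rightarrow> ('b \<Rightarrow> 't set) \<Rightarrow> ('b \<Rightarrow> 't \<Rightarrow> 'x set) \<Rightarrow> 'x \<Rightarrow> nat" where
  "total_mult Bs Ts Y x = (\<Sum>B\<in>Bs. family_mult (Ts B) (Y B) x)"

definition max_children :: "'b set \<Rightarrow> ('b \<Rightarrow> 't set) \<Rightarrow> nat" where
  "max_children Bs Ts = Max ((\<lambda>B. card (Ts B)) ` Bs)"

definition mult_layer :: "'x measure \<Rightarrow> 'l set \<Rightarrow> ('l \<Rightarrow> 'x set) \<Rightarrow> nat \<Rightarrow> 'x set" where
  "mult_layer M F Y k = {x \<in> space M. 2 ^ k \<le> family_mult F Y x \<and> family_mult F Y x < 2 ^ (k + 1)}"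

definition layer_shading ::
  "'x measure \<Rightarrow> ('b \<Rightarrow> 't set) \<Rightarrow> ('b \<Rightarrow> 't \<Rightarrow> 'x set) \<Rightarrow> nat \<Rightarrow> 'b \<Rightarrow> 't \<Rightarrow> 'x set" where
  "layer_shading M Ts Y k B T = Y B T \<inter> mult_layer M (Ts B) (Y B) k"

definition edge_weight ::
  "'x measure \<Rightarrow> ('b \<Rightarrow> 't set) \<Rightarrow> ('b \<Rightarrow> 't \<Rightarrow> 'x set) \<Rightarrow> 'b \<Rightarrow> 'x set \<Rightarrow> ennreal" where
  "edge_weight M Ts Y B Q = (\<Sum>T\<in>Ts B. emeasure M (Y B T \<inter> Q))"

text \<open>Edges are pairs \<open>(B, Q)\<close> of a parent label and an atom (a member of the partition).\<close>

definition edge_region :: "('b \<times> 'x set) set \<Rightarrow> 'b \<Rightarrow> 'x set" where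
  "edge_region E B = \<Union>{Q. (B, Q) \<in> E}"

definition edge_shading ::
  "('b \<times> 'x set) set \<Rightarrow> ('b \<Rightarrow> 't \<Rightarrow> 'x set) \<Rightarrow> 'b \<Rightarrow> 't \<Rightarrow> 'x set" where
  "edge_shading E Y B T = Y B T \<inter> edge_region E B"

definition atom_degree :: "('b \<times> 'x set) set \<Rightarrow> 'x set \<Rightarrow> nat" where
  "atom_degree E Q = card {B. (B, Q) \<in> E}"

definition dyadic :: "real \<Rightarrow> bool" where
  "dyadic d \<longleftrightarrow> (\<exists>i::int. d = 2 powi i)"

text \<open>All edges of \<open>E\<close> at the atoms of the right-degree class \<open>[d, 2d)\<close>; the degree is
  measured in \<open>E\<close> itself, so the selection is saturated.\<close>

definition degree_class_edges :: "('b \<times> 'x set) set \<Rightarrow> real \<Rightarrow> ('b \<times> 'x set) set" where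
  "degree_class_edges E d =
     {(B, Q) \<in> E. d \<le> real (atom_degree E Q) \<and> real (atom_degree E Q) < 2 * d}"

definition largest_degree_class :: "('b \<times> 'x set) set \<Rightarrow> real \<Rightarrow> bool" where
  "largest_degree_class E d \<longleftrightarrow> dyadic d \<and>
     (\<forall>d'. dyadic d' \<longrightarrow> card (degree_class_edges E d') \<le> card (degree_class_edges E d))"

end

theory Submission
  imports Defs
begin

text \<open>
  Everything is reduced to a finite bipartite graph, with parents on the left and atoms on the
  right. As the atoms are disjoint and cover the shadings, the mass of a shading restricted to an
  edge set is the sum of the weights of the edges (\<open>labelled_mass_edges\<close>), the parent
  multiplicity at a point of an atom is the degree of that atom (\<open>family_mult_edge_region\<close>), and
  the total measure of the parent regions is the sum of the atom measures over the edges
  (\<open>sum_emeasure_edge_region\<close>).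

  Three quantities are then made constant up to a factor two, each by a dyadic pigeonhole. The
  child multiplicity lies between \<open>1\<close> and the largest number \<open>N\<close> of children on the union of the
  shadings of a parent, so one of \<open>1 + \<lceil>log 2 N\<rceil>\<close> layers is rich (\<open>layer_pigeonhole\<close>).
  Of the \<open>e\<close> edges of positive weight, those lighter than half the average weight carry at most half of the mass; the other weights
  span a ratio of at most \<open>2 * e\<close>, and a rich weight class exists at the cost of a factor
  \<open>2 * (1 + \<lceil>log 2 (2 * e)\<rceil>)\<close> (\<open>weight_class_pigeonhole\<close>). Atom degrees of the chosen edges lie
  between \<open>1\<close> and \<open>e\<close>, which costs a last factor \<open>1 + \<lceil>log 2 e\<rceil>\<close> (\<open>degree_class_pigeonhole\<close>). The
  last selection keeps all edges at each chosen atom, so the degrees do not change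
  and the new parent multiplicity is exactly the selected one.

  The result survives pruning because after the weight selection the mass of any set of edges is
  its cardinality up to a common constant and a factor two. Losses counted in edges of a degree class
  therefore turn into losses of mass, and so do losses measured by parent regions once the atoms
  have comparable measures (\<open>degree_class_mass\<close>, \<open>pruning_chain\<close>). Child
  multiplicities do not change at the points that remain when edges are removed, because an edge
  carries all children of its parent at the atom (\<open>layer_family_mult\<close>), whereas the number of parents over a point can only
  decrease; this gives the upper bound for the total multiplicity at every stage.
\<close>

section \<open>Dyadic pigeonholing on finite sets\<close>

lemma exists_ge_average:
  fixes f :: "'a \<Rightarrow> 'b :: {linorder, semiring_1, ordered_comm_monoid_add}"
  assumes "finite S" "S \<noteq> {}"
  shows "\<exists>k\<in>S. sum f S \<le> of_nat (card S) * f k"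
proof -
  have "Max (f ` S) \<in> f ` S"
    using assms by (intro Max_in) auto
  then obtain k where k: "k \<in> S" "Max (f ` S) = f k"
    by auto
  have "f a \<le> f k" if "a \<in> S" for a
    using k(2) that assms(1) by (metis Max_ge finite_imageI imageI)
  then have "sum f S \<le> of_nat (card S) * f k"
    by (rule sum_bounded_above)
  with k(1) show ?thesis by blast
qed

lemma dyadic_bracket:
  fixes x R :: real
  assumes "1 \<le> x" "x \<le> R"
  shows "\<exists>k::nat. int k \<le> \<lceil>log 2 R\<rceil> \<and> 2 ^ k \<le> x \<and> x < 2 ^ (k + 1)"
proof -
  define k where "k = nat \<lfloor>log 2 x\<rfloor>"
  have nonneg: "0 \<le> log 2 x"
    using assms(1) by simp
  have k: "real k \<le> log 2 x" "log 2 x < real k + 1"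
    using nonneg unfolding k_def by linarith+
  have "log 2 x \<le> log 2 R"
    using assms by simp
  then have "int k \<le> \<lceil>log 2 R\<rceil>"
    using k(1) by linarith
  moreover have "2 powr real k \<le> x" "x < 2 powr (real k + 1)"
    using k assms(1) by (simp_all add: le_log_iff log_less_iff)
  then have "2 ^ k \<le> x" "x < 2 ^ (k + 1)"
    by (simp_all add: powr_add powr_realpow)
  ultimately show ?thesis by blast
qed

text \<open>The values of \<open>g\<close> meet at most \<open>1 + \<lceil>log 2 R\<rceil>\<close> dyadic classes, and the class of largest
  weight carries at least the average. Weights and sizes are separate arguments since the
  degree selection classifies edges by degree while measuring them by mass.\<close>

lemma dyadic_pigeonhole:
  fixes w g :: "'a \<Rightarrow> real"
  assumes "finite A" "\<And>a. a \<in> A \<Longrightarrow> 0 \<le> w a"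
    and g: "\<And>a. a \<in> A \<Longrightarrow> 1 \<le> g a \<and> g a \<le> R" and "1 \<le> R"
  shows "\<exists>k::nat. sum w A \<le>
    (1 + real_of_int \<lceil>log 2 R\<rceil>) * sum w {a \<in> A. 2 ^ k \<le> g a \<and> g a < 2 ^ (k + 1)}"
proof -
  define K where "K = nat \<lceil>log 2 R\<rceil>"
  have "0 \<le> log 2 R"
    using \<open>1 \<le> R\<close> by simp
  then have K: "int K = \<lceil>log 2 R\<rceil>"
    unfolding K_def by simp
  have "\<exists>k::nat. k \<le> K \<and> 2 ^ k \<le> g a \<and> g a < 2 ^ (k + 1)" if "a \<in> A" for a
    using dyadic_bracket[of "g a" R] g[OF that] K by (metis of_nat_le_iff)
  then obtain c :: "'a \<Rightarrow> nat" where
    c: "\<And>a. a \<in> A \<Longrightarrow> c a \<le> K \<and> 2 ^ c a \<le> g a \<and> g a < 2 ^ (c a + 1)"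
    by metis
  obtain k where k: "(\<Sum>i\<le>K. sum w {a \<in> A. c a = i})
      \<le> of_nat (card {..K}) * sum w {a \<in> A. c a = k}"
    using exists_ge_average[of "{..K}" "\<lambda>i. sum w {a \<in> A. c a = i}"] by auto
  have "sum w A = (\<Sum>i\<le>K. sum w {a \<in> A. c a = i})"
    using \<open>finite A\<close> c by (intro sum.group[symmetric]) auto
  also have "\<dots> \<le> (1 + real K) * sum w {a \<in> A. c a = k}"
    using k by simp
  also have "\<dots> \<le> (1 + real K) * sum w {a \<in> A. 2 ^ k \<le> g a \<and> g a < 2 ^ (k + 1)}"
    using assms(1,2) c by (intro mult_left_mono sum_mono2) auto
  finally show ?thesis
    using K by (metis of_int_of_nat_eq)
qed

text \<open>Here the weights classify themselves. They have no a priori lower bound, so the elements below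
  half the average are discarded first: together they carry at most half of the total.\<close>

lemma weight_class_pigeonhole:
  fixes w :: "'a \<Rightarrow> real"
  assumes "finite E" "E \<noteq> {}" and pos: "\<And>e. e \<in> E \<Longrightarrow> 0 < w e"
  shows "\<exists>\<omega>0>0. sum w E \<le>
    2 * (1 + real_of_int \<lceil>log 2 (2 * real (card E))\<rceil>) * sum w {e \<in> E. \<omega>0 \<le> w e \<and> w e < 2 * \<omega>0}"
proof -
  define b where "b = sum w E / (2 * real (card E))"
  define H where "H = {e \<in> E. b \<le> w e}"
  have card: "1 \<le> card E"
    using assms(1,2) by (simp add: Suc_leI card_gt_0_iff)
  have "0 < sum w E"
    using assms by (intro sum_pos) auto
  then have b: "0 < b"
    using card unfolding b_def by simp
  have "sum w (E - H) \<le> real (card (E - H)) * b"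
    by (rule sum_bounded_above) (auto simp: H_def)
  also have "\<dots> \<le> real (card E) * b"
    using b assms(1) by (intro mult_right_mono) (auto intro: card_mono)
  also have "\<dots> = sum w E / 2"
    using card by (simp add: b_def)
  finally have light: "sum w (E - H) \<le> sum w E / 2" .
  have "sum w E = sum w (E - H) + sum w H"
    using assms(1) by (intro sum.subset_diff) (auto simp: H_def)
  with light have heavy: "sum w E \<le> 2 * sum w H"
    by linarith
  have range: "1 \<le> w e / b \<and> w e / b \<le> 2 * real (card E)" if "e \<in> H" for e
  proof -
    have "e \<in> E" "b \<le> w e"
      using that by (auto simp: H_def)
    moreover have "w e \<le> sum w E"
      using \<open>e \<in> E\<close> assms by (intro member_le_sum) (auto intro: less_imp_le)
    moreover have "sum w E = 2 * real (card E) * b"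
      using card by (simp add: b_def)
    ultimately show ?thesis
      using b by (simp add: field_simps)
  qed
  \<comment> \<open>A single weight is at most the total, that is \<open>2 * card E\<close> times the threshold \<open>b\<close>.\<close>
  obtain k :: nat where k: "sum w H \<le> (1 + real_of_int \<lceil>log 2 (2 * real (card E))\<rceil>) *
      sum w {e \<in> H. 2 ^ k \<le> w e / b \<and> w e / b < 2 ^ (k + 1)}"
    using dyadic_pigeonhole[of H w "\<lambda>e. w e / b" "2 * real (card E)"] range card assms(1) pos
    by (auto simp: H_def less_imp_le)
  define \<omega>0 where "\<omega>0 = 2 ^ k * b"
  have "{e \<in> H. 2 ^ k \<le> w e / b \<and> w e / b < 2 ^ (k + 1)}
      \<subseteq> {e \<in> E. \<omega>0 \<le> w e \<and> w e < 2 * \<omega>0}"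
    using b by (auto simp: H_def \<omega>0_def field_simps)
  then have "sum w {e \<in> H. 2 ^ k \<le> w e / b \<and> w e / b < 2 ^ (k + 1)}
      \<le> sum w {e \<in> E. \<omega>0 \<le> w e \<and> w e < 2 * \<omega>0}"
    using assms(1) pos by (intro sum_mono2) (auto intro: less_imp_le)
  moreover have "0 \<le> log 2 (2 * real (card E))"
    using card by simp
  then have "0 \<le> 1 + real_of_int \<lceil>log 2 (2 * real (card E))\<rceil>"
    by linarith
  ultimately have "sum w H \<le> (1 + real_of_int \<lceil>log 2 (2 * real (card E))\<rceil>) *
      sum w {e \<in> E. \<omega>0 \<le> w e \<and> w e < 2 * \<omega>0}"
    using k by (meson mult_left_mono order_trans)
  then have "sum w E \<le> 2 * (1 + real_of_int \<lceil>log 2 (2 * real (card E))\<rceil>) *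
      sum w {e \<in> E. \<omega>0 \<le> w e \<and> w e < 2 * \<omega>0}"
    using heavy by linarith
  moreover have "0 < \<omega>0"
    using b by (simp add: \<omega>0_def)
  ultimately show ?thesis by blast
qed

section \<open>Right-degree classes of a bipartite edge set\<close>

lemma atom_degree_bounds:
  assumes "finite E" "(B, Q) \<in> E"
  shows "1 \<le> atom_degree E Q" "atom_degree E Q \<le> card E"
proof -
  have "inj_on (\<lambda>B. (B, Q)) {B. (B, Q) \<in> E}"
    by (auto intro: inj_onI)
  moreover have "(\<lambda>B. (B, Q)) ` {B. (B, Q) \<in> E} \<subseteq> E"
    by auto
  ultimately have *: "finite {B. (B, Q) \<in> E}" "card {B. (B, Q) \<in> E} \<le> card E"
    using assms(1) by (auto intro: inj_on_finite card_inj_on_le)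
  then show "atom_degree E Q \<le> card E"
    by (simp add: atom_degree_def)
  show "1 \<le> atom_degree E Q"
    using * assms(2) by (auto simp: atom_degree_def Suc_le_eq card_gt_0_iff)
qed

lemma degree_class_edges_subset: "degree_class_edges E d \<subseteq> E"
  by (auto simp: degree_class_edges_def)

text \<open>Saturation: the class is a condition on the atom alone, so either all edges at an atom survive
  or none do.\<close>

lemma atom_degree_degree_class_edges:
  assumes "(B, Q) \<in> degree_class_edges E d"
  shows "atom_degree (degree_class_edges E d) Q = atom_degree E Q"
    and "d \<le> real (atom_degree E Q)" "real (atom_degree E Q) < 2 * d"
  using assms by (auto simp: degree_class_edges_def atom_degree_def)

lemma degree_class_pigeonhole:
  fixes w :: "'b \<times> 'x set \<Rightarrow> real"
  assumes "finite E" "E \<noteq> {}" "\<And>e. e \<in> E \<Longrightarrow> 0 \<le> w e"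
  shows "\<exists>k::nat. sum w E \<le>
    (1 + real_of_int \<lceil>log 2 (real (card E))\<rceil>) * sum w (degree_class_edges E (2 ^ k))"
proof -
  have "1 \<le> real (card E)"
    using assms(1,2) by (simp add: Suc_leI card_gt_0_iff)
  moreover have "1 \<le> real (atom_degree E (snd e)) \<and> real (atom_degree E (snd e)) \<le> real (card E)"
    if "e \<in> E" for e
    using atom_degree_bounds[OF assms(1), of "fst e" "snd e"] that by simp
  moreover have "{e \<in> E. 2 ^ k \<le> real (atom_degree E (snd e)) \<and>
      real (atom_degree E (snd e)) < 2 ^ (k + 1)} = degree_class_edges E (2 ^ k)" for k
    by (auto simp: degree_class_edges_def)
  ultimately show ?thesis
    using dyadic_pigeonhole[of E w "\<lambda>e. real (atom_degree E (snd e))" "real (card E)"] assms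
    by simp
qed

lemma largest_degree_class_exists:
  assumes "finite E"
  shows "\<exists>d. largest_degree_class E d"
proof -
  have "dyadic 1"
    unfolding dyadic_def by (rule exI[of _ 0]) simp
  moreover have "\<forall>d. dyadic d \<longrightarrow> card (degree_class_edges E d) < Suc (card E)"
    using assms by (simp add: less_Suc_eq_le card_mono degree_class_edges_subset)
  ultimately have "\<exists>d. dyadic d \<and> (\<forall>d'. dyadic d' \<longrightarrow>
      card (degree_class_edges E d') \<le> card (degree_class_edges E d))"
    by (rule ex_has_greatest_nat)
  then show ?thesis
    by (simp add: largest_degree_class_def)
qed

text \<open>The pigeonhole over natural exponents suffices even though \<open>largest_degree_class\<close> compares all
  dyadic \<open>d\<close>: a maximal class is at least as large as the one that the pigeonhole provides.\<close>

lemma largest_degree_class_card: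
  assumes "finite E" "largest_degree_class E d"
  shows "real (card E) \<le>
    (1 + real_of_int \<lceil>log 2 (real (card E))\<rceil>) * real (card (degree_class_edges E d))"
proof (cases "E = {}")
  case False
  then obtain k :: nat where k: "real (card E) \<le>
      (1 + real_of_int \<lceil>log 2 (real (card E))\<rceil>) * real (card (degree_class_edges E (2 ^ k)))"
    using degree_class_pigeonhole[of E "\<lambda>_. 1"] assms(1) by auto
  have "dyadic (2 ^ k)"
    unfolding dyadic_def by (rule exI[of _ "int k"]) simp
  then have "card (degree_class_edges E (2 ^ k)) \<le> card (degree_class_edges E d)"
    using assms(2) by (simp add: largest_degree_class_def)
  moreover have "0 \<le> log 2 (real (card E))"
    using False assms(1) by (simp add: Suc_leI card_gt_0_iff)
  then have "0 \<le> 1 + real_of_int \<lceil>log 2 (real (card E))\<rceil>"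
    by linarith
  ultimately show ?thesis
    using k by (meson mult_left_mono of_nat_mono order_trans)
qed (simp add: degree_class_edges_def)

section \<open>Multiplicity layers\<close>

lemma family_mult_eq_card:
  "finite F \<Longrightarrow> family_mult F Y x = card {T \<in> F. x \<in> Y T}"
  by (simp add: family_mult_def indicator_def sum.If_cases Int_def)

lemma sets_mult_layer:
  assumes "finite F" "\<And>T. T \<in> F \<Longrightarrow> Y T \<in> sets M"
  shows "mult_layer M F Y k \<in> sets M"
proof -
  have [measurable]: "(\<lambda>x. \<Sum>T\<in>F. indicator (Y T) x :: real) \<in> borel_measurable M"
    using assms by (intro borel_measurable_sum borel_measurable_indicator) auto
  have "real (family_mult F Y x) = (\<Sum>T\<in>F. indicator (Y T) x)" for x
    unfolding family_mult_def of_nat_sum by (intro sum.cong refl) (simp add: indicator_def)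
  moreover have "mult_layer M F Y k = {x \<in> space M. 2 ^ k \<le> real (family_mult F Y x) \<and>
      real (family_mult F Y x) < 2 ^ (k + 1)}"
    using of_nat_le_iff[where 'a = real, of "2 ^ k"] of_nat_less_iff[where 'a = real, of _ "2 ^ (k + 1)"]
    by (simp add: mult_layer_def)
  ultimately show ?thesis
    by simp
qed

lemma mult_layer_unique:
  assumes "x \<in> mult_layer M F Y i" "x \<in> mult_layer M F Y j"
  shows "i = j"
proof -
  have "(2::nat) ^ i < 2 ^ (j + 1)" "(2::nat) ^ j < 2 ^ (i + 1)"
    using assms unfolding mult_layer_def by (auto intro: le_less_trans)
  then have "i < j + 1" "j < i + 1"
    by (simp_all add: power_strict_increasing_iff del: power_Suc)
  then show ?thesis by simp
qed

text \<open>A point of some \<open>Y B T\<close> has multiplicity at least \<open>1\<close> (counting \<open>T\<close> itself) and at most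
  \<open>card (Ts B)\<close>, so with \<open>N = max_children Bs Ts\<close> the first \<open>1 + \<lceil>log 2 N\<rceil>\<close> layers cut each shading into disjoint pieces.\<close>

lemma layer_pigeonhole:
  assumes "finite Bs" "Bs \<noteq> {}" and fin: "\<And>B. B \<in> Bs \<Longrightarrow> finite (Ts B)"
    and Y: "\<And>B T. B \<in> Bs \<Longrightarrow> T \<in> Ts B \<Longrightarrow> Y B T \<in> sets M"
    and "1 \<le> max_children Bs Ts"
  shows "\<exists>k. int k \<le> \<lceil>log 2 (real (max_children Bs Ts))\<rceil> \<and>
    labelled_mass M Bs Ts Y \<le> ennreal (1 + real_of_int \<lceil>log 2 (real (max_children Bs Ts))\<rceil>) *
      labelled_mass M Bs Ts (layer_shading M Ts Y k)"
proof -
  define N where "N = max_children Bs Ts"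
  define K where "K = nat \<lceil>log 2 (real N)\<rceil>"
  have "0 \<le> log 2 (real N)"
    using assms(5) by (simp add: N_def)
  then have K: "int K = \<lceil>log 2 (real N)\<rceil>"
    unfolding K_def by simp
  have split: "emeasure M (Y B T) = (\<Sum>k\<le>K. emeasure M (layer_shading M Ts Y k B T))"
    if "B \<in> Bs" "T \<in> Ts B" for B T
  proof -
    have "\<exists>k\<le>K. x \<in> mult_layer M (Ts B) (Y B) k" if "x \<in> Y B T" for x
    proof -
      have "card {T \<in> Ts B. x \<in> Y B T} \<le> card (Ts B)"
        using fin[OF \<open>B \<in> Bs\<close>] by (intro card_mono) auto
      also have "\<dots> \<le> N"
        unfolding N_def max_children_def using assms(1) \<open>B \<in> Bs\<close> by (intro Max_ge) auto
      finally have "family_mult (Ts B) (Y B) x \<le> N"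
        using fin[OF \<open>B \<in> Bs\<close>] by (simp add: family_mult_eq_card)
      moreover have "T \<in> {T \<in> Ts B. x \<in> Y B T}"
        using that \<open>T \<in> Ts B\<close> by simp
      then have "1 \<le> family_mult (Ts B) (Y B) x"
        using fin[OF \<open>B \<in> Bs\<close>] by (auto simp: family_mult_eq_card Suc_le_eq card_gt_0_iff)
      ultimately obtain k :: nat where k: "int k \<le> \<lceil>log 2 (real N)\<rceil>"
          "2 ^ k \<le> real (family_mult (Ts B) (Y B) x)" "real (family_mult (Ts B) (Y B) x) < 2 ^ (k + 1)"
        using dyadic_bracket[of "real (family_mult (Ts B) (Y B) x)" "real N"] by auto
      have "2 ^ k \<le> family_mult (Ts B) (Y B) x \<and> family_mult (Ts B) (Y B) x < 2 ^ (k + 1)"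
        using k(2,3) by (metis of_nat_le_iff of_nat_less_iff of_nat_numeral of_nat_power)
      moreover have "x \<in> space M"
        using Y \<open>B \<in> Bs\<close> \<open>T \<in> Ts B\<close> \<open>x \<in> Y B T\<close> sets.sets_into_space by blast
      ultimately have "x \<in> mult_layer M (Ts B) (Y B) k"
        by (simp add: mult_layer_def)
      moreover have "k \<le> K"
        using k(1) K by simp
      ultimately show ?thesis by blast
    qed
    then have "Y B T = (\<Union>k\<le>K. layer_shading M Ts Y k B T)"
      by (auto simp: layer_shading_def)
    moreover have "(\<Sum>k\<le>K. emeasure M (layer_shading M Ts Y k B T))
        = emeasure M (\<Union>k\<le>K. layer_shading M Ts Y k B T)"
      using that Y fin
      by (intro sum_emeasure)
        (auto simp: layer_shading_def disjoint_family_on_def intro!: sets_mult_layer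
          dest: mult_layer_unique)
    ultimately show ?thesis by simp
  qed
  have "labelled_mass M Bs Ts Y
      = (\<Sum>B\<in>Bs. \<Sum>T\<in>Ts B. \<Sum>k\<le>K. emeasure M (layer_shading M Ts Y k B T))"
    unfolding labelled_mass_def by (intro sum.cong refl split)
  also have "\<dots> = (\<Sum>B\<in>Bs. \<Sum>k\<le>K. \<Sum>T\<in>Ts B. emeasure M (layer_shading M Ts Y k B T))"
    by (intro sum.cong refl sum.swap)
  also have "\<dots> = (\<Sum>k\<le>K. labelled_mass M Bs Ts (layer_shading M Ts Y k))"
    unfolding labelled_mass_def by (rule sum.swap)
  finally have "labelled_mass M Bs Ts Y
      = (\<Sum>k\<le>K. labelled_mass M Bs Ts (layer_shading M Ts Y k))" .
  then obtain k where "k \<le> K" "labelled_mass M Bs Ts Y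
      \<le> of_nat (card {..K}) * labelled_mass M Bs Ts (layer_shading M Ts Y k)"
    using exists_ge_average[of "{..K}" "\<lambda>k. labelled_mass M Bs Ts (layer_shading M Ts Y k)"] by auto
  moreover have "(of_nat (card {..K}) :: ennreal) = ennreal (1 + real_of_int \<lceil>log 2 (real N)\<rceil>)"
    unfolding K[symmetric] by (simp add: ennreal_of_nat_eq_real_of_nat add.commute)
  ultimately show ?thesis
    using K unfolding N_def by (intro exI[of _ k]) auto
qed

lemma family_mult_inter:
  "family_mult F (\<lambda>T. Y T \<inter> A) x = (if x \<in> A then family_mult F Y x else 0)"
  by (simp add: family_mult_def indicator_def)

text \<open>Restricting to a layer and to an edge region removes a point from all shadings of a parent at
  once, so it leaves the multiplicity untouched at the points that remain.\<close>

lemma layer_family_mult: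
  assumes "x \<in> family_union (Ts B) (edge_shading E (layer_shading M Ts Y k) B)"
  shows "family_mult (Ts B) (edge_shading E (layer_shading M Ts Y k) B) x \<in> {2 ^ k..<2 * 2 ^ k}"
proof -
  have "x \<in> mult_layer M (Ts B) (Y B) k" "x \<in> edge_region E B"
    using assms by (auto simp: family_union_def edge_shading_def layer_shading_def)
  moreover have "edge_shading E (layer_shading M Ts Y k) B
      = (\<lambda>T. Y B T \<inter> (mult_layer M (Ts B) (Y B) k \<inter> edge_region E B))"
    by (auto simp: edge_shading_def layer_shading_def)
  ultimately show ?thesis
    by (simp add: family_mult_inter mult_layer_def)
qed

section \<open>Edges carry the mass\<close>

locale atomic_shading =
  fixes M :: "'x measure" and Qs :: "'x set set" and Bs :: "'b set"
    and Ts :: "'b \<Rightarrow> 't set" and Y :: "'b \<Rightarrow> 't \<Rightarrow> 'x set"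
  assumes finite_atoms: "finite Qs" and sets_atoms: "Qs \<subseteq> sets M"
    and disjoint_atoms: "disjoint Qs"
    and finite_parents: "finite Bs" and finite_children: "\<And>B. B \<in> Bs \<Longrightarrow> finite (Ts B)"
    and sets_shading: "\<And>B T. B \<in> Bs \<Longrightarrow> T \<in> Ts B \<Longrightarrow> Y B T \<in> sets M"
    and shading_covered: "\<And>B T. B \<in> Bs \<Longrightarrow> T \<in> Ts B \<Longrightarrow> Y B T \<subseteq> \<Union>Qs"
    and finite_mass: "labelled_mass M Bs Ts Y < \<infinity>"
begin

lemma finite_edges: "E \<subseteq> Bs \<times> Qs \<Longrightarrow> finite E"
  using finite_atoms finite_parents by (meson finite_SigmaI finite_subset)

lemma atom_unique: "Q \<in> Qs \<Longrightarrow> Q' \<in> Qs \<Longrightarrow> x \<in> Q \<Longrightarrow> x \<in> Q' \<Longrightarrow> Q = Q'"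
  using disjoint_atoms by (meson disjointD disjoint_iff)

lemma edge_region_sets: "E \<subseteq> Bs \<times> Qs \<Longrightarrow> edge_region E B \<in> sets M"
  unfolding edge_region_def
  using finite_atoms sets_atoms
  by (intro sets.finite_Union) (auto intro: finite_subset[of _ Qs])

lemma sum_edges:
  assumes "E \<subseteq> Bs \<times> Qs"
  shows "(\<Sum>B\<in>Bs. \<Sum>Q | (B, Q) \<in> E. h B Q) = (\<Sum>(B, Q)\<in>E. h B Q)"
proof -
  have "finite {Q. (B, Q) \<in> E}" for B
    using finite_atoms assms by (auto intro: finite_subset[of _ Qs])
  then have "(\<Sum>B\<in>Bs. \<Sum>Q | (B, Q) \<in> E. h B Q)
      = (\<Sum>(B, Q)\<in>Sigma Bs (\<lambda>B. {Q. (B, Q) \<in> E}). h B Q)"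
    using finite_parents by (intro sum.Sigma) auto
  also have "Sigma Bs (\<lambda>B. {Q. (B, Q) \<in> E}) = E"
    using assms by auto
  finally show ?thesis .
qed

lemma emeasure_inter_edge_region:
  assumes "E \<subseteq> Bs \<times> Qs" "A \<in> sets M"
  shows "emeasure M (A \<inter> edge_region E B) = (\<Sum>Q | (B, Q) \<in> E. emeasure M (A \<inter> Q))"
proof -
  have sub: "{Q. (B, Q) \<in> E} \<subseteq> Qs"
    using assms(1) by auto
  have "A \<inter> edge_region E B = (\<Union>Q\<in>{Q. (B, Q) \<in> E}. A \<inter> Q)"
    by (auto simp: edge_region_def)
  moreover have "(\<Sum>Q | (B, Q) \<in> E. emeasure M (A \<inter> Q))
      = emeasure M (\<Union>Q\<in>{Q. (B, Q) \<in> E}. A \<inter> Q)"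
  proof (rule sum_emeasure)
    show "(\<lambda>Q. A \<inter> Q) ` {Q. (B, Q) \<in> E} \<subseteq> sets M"
      using sub sets_atoms assms(2) by auto
    show "disjoint_family_on (\<lambda>Q. A \<inter> Q) {Q. (B, Q) \<in> E}"
      using sub atom_unique by (fastforce simp: disjoint_family_on_def)
    show "finite {Q. (B, Q) \<in> E}"
      using sub finite_atoms by (rule finite_subset)
  qed
  ultimately show ?thesis by simp
qed

text \<open>In the pruning hypothesis mass is lost in terms of parent regions; this identity turns that
  into a statement about edges.\<close>

lemma sum_emeasure_edge_region:
  assumes "E \<subseteq> Bs \<times> Qs"
  shows "(\<Sum>B\<in>Bs. emeasure M (edge_region E B)) = (\<Sum>(B, Q)\<in>E. emeasure M Q)"
proof -
  have "emeasure M (edge_region E B) = (\<Sum>Q | (B, Q) \<in> E. emeasure M Q)" for B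
  proof -
    have "space M \<inter> edge_region E B = edge_region E B"
      using edge_region_sets[OF assms] sets.sets_into_space by blast
    moreover have "space M \<inter> Q = Q" if "(B, Q) \<in> E" for Q
      using that assms sets_atoms sets.sets_into_space by blast
    ultimately show ?thesis
      using emeasure_inter_edge_region[OF assms sets.top, of B] sum.cong by simp
  qed
  then show ?thesis
    using sum_edges[OF assms, of "\<lambda>B Q. emeasure M Q"] by simp
qed

lemma labelled_mass_edge_shading:
  assumes "E \<subseteq> Bs \<times> Qs"
  shows "labelled_mass M Bs Ts (edge_shading E Y) = (\<Sum>(B, Q)\<in>E. edge_weight M Ts Y B Q)"
proof -
  have "labelled_mass M Bs Ts (edge_shading E Y)
      = (\<Sum>B\<in>Bs. \<Sum>T\<in>Ts B. \<Sum>Q | (B, Q) \<in> E. emeasure M (Y B T \<inter> Q))"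
    unfolding labelled_mass_def edge_shading_def
    by (intro sum.cong refl emeasure_inter_edge_region assms sets_shading)
  also have "\<dots> = (\<Sum>B\<in>Bs. \<Sum>Q | (B, Q) \<in> E. edge_weight M Ts Y B Q)"
    unfolding edge_weight_def by (intro sum.cong refl sum.swap)
  finally show ?thesis
    using sum_edges[OF assms] by simp
qed

lemma labelled_mass_all_edges:
  "labelled_mass M Bs Ts Y = (\<Sum>(B, Q)\<in>Bs \<times> Qs. edge_weight M Ts Y B Q)"
proof -
  have "edge_shading (Bs \<times> Qs) Y B T = Y B T" if "B \<in> Bs" "T \<in> Ts B" for B T
    using shading_covered[OF that] that by (auto simp: edge_shading_def edge_region_def)
  then have "labelled_mass M Bs Ts Y = labelled_mass M Bs Ts (edge_shading (Bs \<times> Qs) Y)"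
    by (simp add: labelled_mass_def)
  then show ?thesis
    using labelled_mass_edge_shading[of "Bs \<times> Qs"] by simp
qed

text \<open>Since the total mass is finite, no edge weight is infinite, and the combinatorial
  selection can take place in the reals.\<close>

definition weight :: "'b \<times> 'x set \<Rightarrow> real" where
  "weight e = enn2real (edge_weight M Ts Y (fst e) (snd e))"

lemma ennreal_weight:
  assumes "(B, Q) \<in> Bs \<times> Qs"
  shows "ennreal (weight (B, Q)) = edge_weight M Ts Y B Q"
proof -
  have "edge_weight M Ts Y B Q = (case (B, Q) of (B, Q) \<Rightarrow> edge_weight M Ts Y B Q)"
    by simp
  also have "\<dots> \<le> labelled_mass M Bs Ts Y"
    unfolding labelled_mass_all_edges
    using assms finite_parents finite_atoms by (intro member_le_sum) auto
  finally show ?thesis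
    using finite_mass by (simp add: weight_def)
qed

lemma weight_nonneg: "0 \<le> weight e"
  by (simp add: weight_def)

lemma weight_pos_iff:
  "(B, Q) \<in> Bs \<times> Qs \<Longrightarrow> 0 < weight (B, Q) \<longleftrightarrow> 0 < edge_weight M Ts Y B Q"
  using ennreal_weight[of B Q] by (metis ennreal_less_zero_iff)

lemma sum_edge_weight:
  assumes "E \<subseteq> Bs \<times> Qs"
  shows "(\<Sum>(B, Q)\<in>E. edge_weight M Ts Y B Q) = ennreal (sum weight E)"
proof -
  have "(\<Sum>(B, Q)\<in>E. edge_weight M Ts Y B Q) = (\<Sum>e\<in>E. ennreal (weight e))"
    using assms ennreal_weight by (intro sum.cong) auto
  then show ?thesis
    by (simp add: weight_nonneg)
qed

lemma labelled_mass_edges: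
  "E \<subseteq> Bs \<times> Qs \<Longrightarrow> labelled_mass M Bs Ts (edge_shading E Y) = ennreal (sum weight E)"
  by (simp add: labelled_mass_edge_shading sum_edge_weight)

lemma labelled_mass_positive_edges:
  "labelled_mass M Bs Ts Y = ennreal (sum weight {(B, Q) \<in> Bs \<times> Qs. 0 < edge_weight M Ts Y B Q})"
proof -
  have "sum weight (Bs \<times> Qs) = sum weight {(B, Q) \<in> Bs \<times> Qs. 0 < edge_weight M Ts Y B Q}"
    using finite_parents finite_atoms
    by (intro sum.mono_neutral_right) (auto simp: weight_def zero_less_iff_neq_zero)
  then show ?thesis
    by (simp add: labelled_mass_all_edges sum_edge_weight)
qed

lemma family_mult_edge_region:
  assumes "E \<subseteq> Bs \<times> Qs" "Q \<in> Qs" "x \<in> Q"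
  shows "family_mult Bs (edge_region E) x = atom_degree E Q"
proof -
  have "{B \<in> Bs. x \<in> edge_region E B} = {B. (B, Q) \<in> E}"
    using assms atom_unique[OF assms(2)] by (auto simp: edge_region_def)
  then show ?thesis
    using finite_parents by (simp add: family_mult_eq_card atom_degree_def)
qed

lemma family_mult_degree_class:
  assumes "E \<subseteq> Bs \<times> Qs" and "x \<in> family_union Bs (edge_region (degree_class_edges E d))"
  shows "real (family_mult Bs (edge_region (degree_class_edges E d)) x) \<in> {d..<2 * d}"
proof -
  obtain B Q where BQ: "(B, Q) \<in> degree_class_edges E d" "x \<in> Q"
    using assms(2) by (auto simp: family_union_def edge_region_def)
  have sub: "degree_class_edges E d \<subseteq> Bs \<times> Qs"
    using assms(1) degree_class_edges_subset by blast
  then have "family_mult Bs (edge_region (degree_class_edges E d)) x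
      = atom_degree (degree_class_edges E d) Q"
    using BQ by (intro family_mult_edge_region) auto
  then show ?thesis
    using atom_degree_degree_class_edges[OF BQ(1)] by simp
qed

text \<open>An edge of positive weight has a child of positive measure inside its atom. Conversely, the
  restricted shading only reaches atoms of selected edges, as distinct atoms are disjoint.\<close>

lemma edge_region_eq_heavy_atoms:
  assumes "E \<subseteq> Bs \<times> Qs" "\<And>B Q. (B, Q) \<in> E \<Longrightarrow> 0 < edge_weight M Ts Y B Q" "B \<in> Bs"
  shows "edge_region E B = \<Union>{Q \<in> Qs. 0 < emeasure M (Q \<inter> family_union (Ts B) (edge_shading E Y B))}"
proof -
  have "(B, Q) \<in> E \<longleftrightarrow> Q \<in> Qs \<and> 0 < emeasure M (Q \<inter> family_union (Ts B) (edge_shading E Y B))" for Q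
  proof
    assume edge: "(B, Q) \<in> E"
    then have "Q \<in> Qs"
      using assms(1) by auto
    have "edge_weight M Ts Y B Q \<noteq> 0"
      using assms(2)[OF edge] by simp
    then obtain T where T: "T \<in> Ts B" "emeasure M (Y B T \<inter> Q) \<noteq> 0"
      by (auto simp: edge_weight_def finite_children[OF assms(3)])
    have "family_union (Ts B) (edge_shading E Y B) \<in> sets M"
      unfolding family_union_def edge_shading_def
      using finite_children[OF assms(3)] sets_shading[OF assms(3)] edge_region_sets[OF assms(1)]
      by (intro sets.finite_UN) auto
    then have "emeasure M (Y B T \<inter> Q) \<le> emeasure M (Q \<inter> family_union (Ts B) (edge_shading E Y B))"
      using T(1) edge \<open>Q \<in> Qs\<close> sets_atoms
      by (intro emeasure_mono) (auto simp: family_union_def edge_shading_def edge_region_def)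
    then show "Q \<in> Qs \<and> 0 < emeasure M (Q \<inter> family_union (Ts B) (edge_shading E Y B))"
      using T(2) \<open>Q \<in> Qs\<close> by (metis not_gr_zero le_zero_eq)
  next
    assume Q: "Q \<in> Qs \<and> 0 < emeasure M (Q \<inter> family_union (Ts B) (edge_shading E Y B))"
    then have "Q \<inter> family_union (Ts B) (edge_shading E Y B) \<noteq> {}"
      by (metis emeasure_empty less_irrefl)
    then obtain x Q' where x: "x \<in> Q" "x \<in> Q'" "(B, Q') \<in> E"
      by (auto simp: family_union_def edge_shading_def edge_region_def)
    then have "Q' = Q"
      using Q assms(1) atom_unique by (metis SigmaD2 subsetD)
    with x(3) show "(B, Q) \<in> E" by simp
  qed
  then show ?thesis
    by (auto simp: edge_region_def)
qed

lemma total_mult_le: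
  assumes "\<And>B x. B \<in> Bs \<Longrightarrow> x \<in> family_union (Ts B) (edge_shading E Y B) \<Longrightarrow>
      family_mult (Ts B) (edge_shading E Y B) x \<in> {\<mu>..<2 * \<mu>}"
  shows "total_mult Bs Ts (edge_shading E Y) x \<le> 2 * \<mu> * family_mult Bs (edge_region E) x"
proof -
  have "family_mult (Ts B) (edge_shading E Y B) x \<le> 2 * \<mu> * indicator (edge_region E B) x"
    if "B \<in> Bs" for B
  proof (cases "x \<in> family_union (Ts B) (edge_shading E Y B)")
    case True
    then have "x \<in> edge_region E B"
      by (auto simp: family_union_def edge_shading_def)
    then show ?thesis
      using assms[OF that True] by simp
  next
    case False
    then have "family_mult (Ts B) (edge_shading E Y B) x = 0"
      by (auto simp: family_mult_def family_union_def indicator_def)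
    then show ?thesis by simp
  qed
  then show ?thesis
    unfolding total_mult_def family_mult_def[of Bs] sum_distrib_left by (rule sum_mono)
qed

end

section \<open>Pruning a set of edges of comparable weight\<close>

locale comparable_edges = atomic_shading +
  fixes E0 :: "('b \<times> 'a set) set" and \<omega>0 :: real
  assumes E0_edges: "E0 \<subseteq> Bs \<times> Qs" and E0_nonempty: "E0 \<noteq> {}"
    and \<omega>0_pos: "0 < \<omega>0"
    and weight_comparable: "\<And>e. e \<in> E0 \<Longrightarrow> \<omega>0 \<le> weight e \<and> weight e < 2 * \<omega>0"
begin

lemma card_le_weight:
  assumes "E \<subseteq> E0"
  shows "\<omega>0 * real (card E) \<le> sum weight E"
  using sum_bounded_below[of E \<omega>0 weight] weight_comparable assms by (auto simp: mult.commute)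

lemma weight_le_card:
  assumes "E \<subseteq> E0"
  shows "sum weight E \<le> 2 * \<omega>0 * real (card E)"
proof -
  have "weight e \<le> 2 * \<omega>0" if "e \<in> E" for e
    using that assms weight_comparable[of e] by auto
  then have "sum weight E \<le> of_nat (card E) * (2 * \<omega>0)"
    by (rule sum_bounded_above)
  then show ?thesis
    by (simp add: mult_ac)
qed

text \<open>The class is chosen by its number of edges, not by its mass; comparability of the weights
  accounts for the additional factor \<open>2\<close>.\<close>

lemma degree_class_mass:
  assumes "E \<subseteq> E0" "largest_degree_class E d"
  shows "ennreal (1 / (2 * (1 + real_of_int \<lceil>log 2 (real (card E))\<rceil>)))
      * labelled_mass M Bs Ts (edge_shading E Y)
    \<le> labelled_mass M Bs Ts (edge_shading (degree_class_edges E d) Y)"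
proof -
  define C where "C = 1 + real_of_int \<lceil>log 2 (real (card E))\<rceil>"
  have sub: "degree_class_edges E d \<subseteq> E0"
    using assms(1) degree_class_edges_subset by blast
  have fin: "finite E"
    using assms(1) E0_edges finite_edges by blast
  \<comment> \<open>For empty \<open>E\<close> this relies on \<open>log 2 0 = 0\<close>.\<close>
  have "1 \<le> C"
  proof (cases "E = {}")
    case False
    then have "0 \<le> log 2 (real (card E))"
      using fin by (simp add: Suc_leI card_gt_0_iff)
    then show ?thesis
      unfolding C_def by linarith
  qed (simp add: C_def log_def)
  have "sum weight E \<le> 2 * \<omega>0 * real (card E)"
    by (rule weight_le_card[OF assms(1)])
  also have "\<dots> \<le> 2 * \<omega>0 * (C * real (card (degree_class_edges E d)))"
    using largest_degree_class_card[OF fin assms(2)] \<omega>0_pos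
    unfolding C_def by (intro mult_left_mono) auto
  also have "\<dots> = 2 * C * (\<omega>0 * real (card (degree_class_edges E d)))"
    by simp
  also have "\<dots> \<le> 2 * C * sum weight (degree_class_edges E d)"
    using card_le_weight[OF sub] \<open>1 \<le> C\<close> by (intro mult_left_mono) auto
  finally have "1 / (2 * C) * sum weight E \<le> sum weight (degree_class_edges E d)"
    using \<open>1 \<le> C\<close> by (simp add: field_simps)
  moreover have "E \<subseteq> Bs \<times> Qs" "degree_class_edges E d \<subseteq> Bs \<times> Qs"
    using assms(1) sub E0_edges by auto
  ultimately show ?thesis
    using \<open>1 \<le> C\<close> unfolding C_def[symmetric]
    by (simp add: labelled_mass_edges ennreal_mult'[symmetric] sum_nonneg weight_nonneg ennreal_leI)
qed

lemma atom_ratio_ge_1: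
  assumes "0 < q0"
    and q: "\<And>B Q. (B, Q) \<in> E0 \<Longrightarrow> ennreal q0 \<le> emeasure M Q \<and> emeasure M Q \<le> ennreal (\<kappa> * q0)"
  shows "1 \<le> \<kappa>"
proof -
  obtain B1 Q1 where "(B1, Q1) \<in> E0"
    using E0_nonempty by auto
  then have "ennreal q0 \<le> ennreal (\<kappa> * q0)"
    using q order_trans by blast
  then show ?thesis
    using \<open>0 < q0\<close> by (simp add: ennreal_le_iff2)
qed

text \<open>Counting links measure to mass: atom measures are comparable up to \<open>\<kappa>\<close>, so retaining a
  fraction \<open>c\<close> of the parent measure retains a fraction \<open>c / \<kappa>\<close> of the number of edges, and edge
  weights are comparable up to \<open>2\<close>, so it retains a fraction \<open>c / (2 * \<kappa>)\<close> of the mass.\<close>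

lemma pruning_step:
  assumes "0 < q0" "0 \<le> c"
    and q: "\<And>B Q. (B, Q) \<in> E0 \<Longrightarrow> ennreal q0 \<le> emeasure M Q \<and> emeasure M Q \<le> ennreal (\<kappa> * q0)"
    and "E \<subseteq> E0" "E' \<subseteq> E0"
    and retained: "ennreal c * (\<Sum>B\<in>Bs. emeasure M (edge_region E B))
      \<le> (\<Sum>B\<in>Bs. emeasure M (edge_region E' B))"
  shows "c / (2 * \<kappa>) * sum weight E \<le> sum weight E'"
proof -
  have \<kappa>: "1 \<le> \<kappa>"
    using \<open>0 < q0\<close> q by (rule atom_ratio_ge_1)
  have edges: "E \<subseteq> Bs \<times> Qs" "E' \<subseteq> Bs \<times> Qs"
    using assms(4,5) E0_edges by auto
  have "ennreal (c * (q0 * real (card E))) = ennreal c * (of_nat (card E) * ennreal q0)"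
    using \<open>0 < q0\<close> \<open>0 \<le> c\<close>
    by (simp add: ennreal_mult ennreal_of_nat_eq_real_of_nat mult.commute)
  also have "\<dots> \<le> ennreal c * (\<Sum>(B, Q)\<in>E. emeasure M Q)"
    using q assms(4) by (intro mult_left_mono sum_bounded_below) auto
  also have "\<dots> \<le> (\<Sum>(B, Q)\<in>E'. emeasure M Q)"
    using retained by (simp add: sum_emeasure_edge_region edges)
  also have "\<dots> \<le> of_nat (card E') * ennreal (\<kappa> * q0)"
    using q assms(5) by (intro sum_bounded_above) auto
  also have "\<dots> = ennreal (real (card E') * (\<kappa> * q0))"
    using \<open>0 < q0\<close> \<kappa> by (simp add: ennreal_mult ennreal_of_nat_eq_real_of_nat)
  finally have "c * (q0 * real (card E)) \<le> real (card E') * (\<kappa> * q0)"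
    using \<open>0 < q0\<close> \<kappa> by (simp add: ennreal_le_iff)
  then have "q0 * (c * real (card E)) \<le> q0 * (\<kappa> * real (card E'))"
    by (simp add: mult_ac)
  then have count: "c * real (card E) \<le> \<kappa> * real (card E')"
    using \<open>0 < q0\<close> by simp
  have "c * sum weight E \<le> c * (2 * \<omega>0 * real (card E))"
    using weight_le_card[OF assms(4)] \<open>0 \<le> c\<close> by (rule mult_left_mono)
  also have "\<dots> = 2 * \<omega>0 * (c * real (card E))"
    by simp
  also have "\<dots> \<le> 2 * \<omega>0 * (\<kappa> * real (card E'))"
    using count \<omega>0_pos by (intro mult_left_mono) auto
  also have "\<dots> = 2 * \<kappa> * (\<omega>0 * real (card E'))"
    by simp
  also have "\<dots> \<le> 2 * \<kappa> * sum weight E'"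
    using card_le_weight[OF assms(5)] \<kappa> by (intro mult_left_mono) auto
  finally show ?thesis
    using \<kappa> by (simp add: field_simps)
qed

lemma pruning_chain:
  fixes E :: "nat \<Rightarrow> ('b \<times> 'a set) set"
  assumes "0 < q0"
    and q: "\<And>B Q. (B, Q) \<in> E0 \<Longrightarrow> ennreal q0 \<le> emeasure M Q \<and> emeasure M Q \<le> ennreal (\<kappa> * q0)"
    and "E 0 = E0" and sub: "\<And>j. j \<le> m \<Longrightarrow> E j \<subseteq> E0"
    and c: "\<And>j. j \<in> {1..m} \<Longrightarrow> 0 < c j \<and> ennreal (c j) * (\<Sum>B\<in>Bs. emeasure M (edge_region (E (j - 1)) B))
        \<le> (\<Sum>B\<in>Bs. emeasure M (edge_region (E j) B))"
  shows "(\<Prod>j=1..m. c j / (2 * \<kappa>)) * sum weight E0 \<le> sum weight (E m)"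
  using sub c
proof (induction m)
  case 0
  then show ?case using \<open>E 0 = E0\<close> by simp
next
  case (Suc m)
  have \<kappa>: "1 \<le> \<kappa>"
    using \<open>0 < q0\<close> q by (rule atom_ratio_ge_1)
  have cm: "0 < c (Suc m)"
    using Suc.prems(2)[of "Suc m"] by simp
  have "(\<Prod>j=1..Suc m. c j / (2 * \<kappa>)) * sum weight E0
      = c (Suc m) / (2 * \<kappa>) * ((\<Prod>j=1..m. c j / (2 * \<kappa>)) * sum weight E0)"
    by simp
  also have "\<dots> \<le> c (Suc m) / (2 * \<kappa>) * sum weight (E m)"
  proof (rule mult_left_mono)
    show "(\<Prod>j=1..m. c j / (2 * \<kappa>)) * sum weight E0 \<le> sum weight (E m)"
      using Suc.prems by (intro Suc.IH) auto
    show "0 \<le> c (Suc m) / (2 * \<kappa>)"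
      using cm \<kappa> by simp
  qed
  also have "\<dots> \<le> sum weight (E (Suc m))"
    using Suc.prems(1)[of m] Suc.prems(1)[of "Suc m"] Suc.prems(2)[of "Suc m"] cm
    by (intro pruning_step[OF \<open>0 < q0\<close> _ q]) auto
  finally show ?case .
qed

end

theorem theorem5p6:
  fixes M :: "'x measure" and X0 :: "'x set" and Qs :: "'x set set"
    and Bs :: "'b set" and Ts :: "'b \<Rightarrow> 't set" and Y :: "'b \<Rightarrow> 't \<Rightarrow> 'x set"
  assumes "X0 \<in> sets M"
    and "finite Qs" and "Qs \<subseteq> sets M" and "partition_on X0 Qs"
    and "finite Bs" and "Bs \<noteq> {}"
    and "\<And>B. B \<in> Bs \<Longrightarrow> finite (Ts B)"
    and "\<And>B T. B \<in> Bs \<Longrightarrow> T \<in> Ts B \<Longrightarrow> Y B T \<in> sets M \<and> Y B T \<subseteq> X0"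
    and "0 < labelled_mass M Bs Ts Y" and "labelled_mass M Bs Ts Y < \<infinity>"
  shows "\<exists>(k0::nat) (E2 :: ('b \<times> 'x set) set) (\<omega>0::real) (d0::real) (L::real).
    (let N = max_children Bs Ts;
         \<mu> = (2::nat) ^ k0;
         Y0 = layer_shading M Ts Y k0;
         \<omega> = edge_weight M Ts Y0;
         Y1 = edge_shading E2 Y0;
         Z = edge_region E2;
         e = card {(B, Q) \<in> Bs \<times> Qs. 0 < \<omega> B Q}
     in
       int k0 \<le> \<lceil>log 2 (real N)\<rceil> \<and>
       E2 \<subseteq> Bs \<times> Qs \<and>
       0 < \<omega>0 \<and> 0 < d0 \<and>
       (\<forall>(B, Q)\<in>E2. 0 < \<omega> B Q \<and> ennreal \<omega>0 \<le> \<omega> B Q \<and> \<omega> B Q < ennreal (2 * \<omega>0)) \<and>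
       0 < L \<and>
       L \<le> 4 * (1 + real_of_int \<lceil>log 2 (real N)\<rceil>)
             * (1 + real_of_int \<lceil>log 2 (2 * real e)\<rceil>)
             * (1 + real_of_int \<lceil>log 2 (real e)\<rceil>) \<and>
       ennreal (inverse L) * labelled_mass M Bs Ts Y \<le> labelled_mass M Bs Ts Y1 \<and>
       \<comment> \<open>(A1)\<close>
       (\<forall>B\<in>Bs. (\<forall>T\<in>Ts B. Y1 B T \<subseteq> Z B) \<and>
          Z B = \<Union>{Q \<in> Qs. 0 < emeasure M (Q \<inter> family_union (Ts B) (Y1 B))}) \<and>
       \<comment> \<open>(A2)\<close>
       (\<forall>B\<in>Bs. \<forall>x\<in>family_union (Ts B) (Y1 B). family_mult (Ts B) (Y1 B) x \<in> {\<mu>..<2 * \<mu>}) \<and>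
       \<comment> \<open>(A3)\<close>
       (\<forall>x\<in>family_union Bs Z. real (family_mult Bs Z x) \<in> {d0..<2 * d0}) \<and>
       \<comment> \<open>(A4)\<close>
       (\<forall>x\<in>space M. real (total_mult Bs Ts Y1 x) < 4 * real \<mu> * d0) \<and>
       \<comment> \<open>stability under further edge pruning\<close>
       (\<forall>(q0::real) (\<kappa>::real) (m::nat) (E :: nat \<Rightarrow> ('b \<times> 'x set) set) (c :: nat \<Rightarrow> real).
          0 < q0 \<longrightarrow>
          (\<forall>(B, Q)\<in>E2. ennreal q0 \<le> emeasure M Q \<and> emeasure M Q \<le> ennreal (\<kappa> * q0)) \<longrightarrow>
          E 0 = E2 \<longrightarrow>
          (\<forall>j\<in>{1..m}. E j \<subseteq> E (j - 1)) \<longrightarrow>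
          (\<forall>j\<in>{1..m}. 0 < c j \<and> c j \<le> 1 \<and>
             ennreal (c j) * (\<Sum>B\<in>Bs. emeasure M (edge_region (E (j - 1)) B))
               \<le> (\<Sum>B\<in>Bs. emeasure M (edge_region (E j) B))) \<longrightarrow>
          ennreal (inverse L * (\<Prod>j=1..m. c j / (2 * \<kappa>))) * labelled_mass M Bs Ts Y
            \<le> labelled_mass M Bs Ts (edge_shading (E m) Y0) \<and>
          (\<forall>j\<in>{0..m}.
             (let Yj = edge_shading (E j) Y0 in
               (\<forall>B\<in>Bs. \<forall>x\<in>family_union (Ts B) (Yj B).
                  family_mult (Ts B) (Yj B) x \<in> {\<mu>..<2 * \<mu>}) \<and>
               (\<forall>x\<in>space M. real (total_mult Bs Ts Yj x) < 4 * real \<mu> * d0) \<and>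
               \<comment> \<open>saturated dyadic right-degree selection\<close>
               (\<exists>d. largest_degree_class (E j) d) \<and>
               (\<forall>d. largest_degree_class (E j) d \<longrightarrow>
                  (let E' = degree_class_edges (E j) d in
                    (\<forall>x\<in>family_union Bs (edge_region E').
                       real (family_mult Bs (edge_region E') x) \<in> {d..<2 * d}) \<and>
                    ennreal (1 / (2 * (1 + real_of_int \<lceil>log 2 (real (card (E j)))\<rceil>)))
                        * labelled_mass M Bs Ts Yj
                      \<le> labelled_mass M Bs Ts (edge_shading E' Y0)))))))"
proof -
  define N where "N = max_children Bs Ts"
  define a where "a = 1 + real_of_int \<lceil>log 2 (real N)\<rceil>"
  have "labelled_mass M Bs Ts Y \<noteq> 0"
    using assms(9) by simp
  then obtain B T where "B \<in> Bs" "T \<in> Ts B"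
    unfolding labelled_mass_def by (meson sum.neutral)
  then have "1 \<le> card (Ts B)"
    using assms(7)[OF \<open>B \<in> Bs\<close>] by (auto simp: Suc_le_eq card_gt_0_iff)
  also have "card (Ts B) \<le> N"
    unfolding N_def max_children_def using \<open>finite Bs\<close> \<open>B \<in> Bs\<close> by (intro Max_ge) auto
  finally have N: "1 \<le> N" .
  then have "0 \<le> log 2 (real N)"
    by simp
  then have a: "1 \<le> a"
    unfolding a_def by linarith
  obtain k0 where k0: "int k0 \<le> \<lceil>log 2 (real N)\<rceil>"
    and layer: "labelled_mass M Bs Ts Y \<le> ennreal a * labelled_mass M Bs Ts (layer_shading M Ts Y k0)"
    using layer_pigeonhole[of Bs Ts Y M] assms(5-8) N unfolding N_def a_def by blast
  define Y0 where "Y0 = layer_shading M Ts Y k0"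
  have Y0_sets: "Y0 B T \<in> sets M" if "B \<in> Bs" "T \<in> Ts B" for B T
    using that assms(7,8) by (auto simp: Y0_def layer_shading_def intro!: sets_mult_layer)
  have Y0_sub: "Y0 B T \<subseteq> Y B T" for B T
    by (auto simp: Y0_def layer_shading_def)
  have "labelled_mass M Bs Ts Y0 \<le> labelled_mass M Bs Ts Y"
    unfolding labelled_mass_def using assms(8) Y0_sub by (intro sum_mono emeasure_mono) auto
  then have Y0_finite: "labelled_mass M Bs Ts Y0 < \<infinity>"
    using assms(10) by (rule le_less_trans)
  interpret atomic_shading M Qs Bs Ts Y0
  proof
    show "disjoint Qs" "\<And>B T. B \<in> Bs \<Longrightarrow> T \<in> Ts B \<Longrightarrow> Y0 B T \<subseteq> \<Union>Qs"
      using assms(4,8) Y0_sub by (blast dest: partition_onD1 partition_onD2)+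
  qed (use assms Y0_sets Y0_finite in auto)
  define P where "P = {(B, Q) \<in> Bs \<times> Qs. 0 < edge_weight M Ts Y0 B Q}"
  have P_sub: "P \<subseteq> Bs \<times> Qs"
    by (auto simp: P_def)
  have P_finite: "finite P"
    using P_sub by (rule finite_edges)
  have "labelled_mass M Bs Ts Y0 = ennreal (sum weight P)"
    unfolding P_def by (rule labelled_mass_positive_edges)
  then have mass_P: "labelled_mass M Bs Ts Y \<le> ennreal (a * sum weight P)"
    using layer a by (simp add: Y0_def[symmetric] ennreal_mult')
  then have "0 < ennreal (a * sum weight P)"
    using assms(9) less_le_trans by blast
  then have P_pos: "0 < sum weight P"
    using a by (simp add: zero_less_mult_iff)
  then have "P \<noteq> {}"
    by auto
  have weight_P: "0 < weight e" if "e \<in> P" for e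
    using that weight_pos_iff by (auto simp: P_def)
  define b where "b = 1 + real_of_int \<lceil>log 2 (2 * real (card P))\<rceil>"
  define c where "c = 1 + real_of_int \<lceil>log 2 (real (card P))\<rceil>"
  have card_P: "1 \<le> card P"
    using P_finite \<open>P \<noteq> {}\<close> by (simp add: Suc_leI card_gt_0_iff)
  then have "0 \<le> log 2 (real (card P))" "0 \<le> log 2 (2 * real (card P))"
    by simp_all
  then have b: "1 \<le> b" and c: "1 \<le> c"
    unfolding b_def c_def by linarith+
  obtain \<omega>0 where \<omega>0: "0 < \<omega>0"
    "sum weight P \<le> 2 * b * sum weight {e \<in> P. \<omega>0 \<le> weight e \<and> weight e < 2 * \<omega>0}"
    using weight_class_pigeonhole[OF P_finite \<open>P \<noteq> {}\<close>, of weight] weight_P unfolding b_def by blast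
  define E1 where "E1 = {e \<in> P. \<omega>0 \<le> weight e \<and> weight e < 2 * \<omega>0}"
  have "0 < 2 * b * sum weight E1"
    using P_pos \<omega>0(2) unfolding E1_def by (rule less_le_trans)
  then have "E1 \<noteq> {}"
    by auto
  have E1_P: "E1 \<subseteq> P"
    by (auto simp: E1_def)
  have E1_finite: "finite E1"
    using E1_P P_finite by (rule finite_subset)
  obtain k :: nat where k: "sum weight E1
      \<le> (1 + real_of_int \<lceil>log 2 (real (card E1))\<rceil>) * sum weight (degree_class_edges E1 (2 ^ k))"
    using degree_class_pigeonhole[OF E1_finite \<open>E1 \<noteq> {}\<close>, of weight] weight_nonneg by blast
  define d0 where "d0 = (2 :: real) ^ k"
  define E2 where "E2 = degree_class_edges E1 d0"
  have E2_E1: "E2 \<subseteq> E1"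
    unfolding E2_def by (rule degree_class_edges_subset)
  then have E2_sub: "E2 \<subseteq> Bs \<times> Qs"
    using E1_P P_sub by blast
  have "1 \<le> card E1" "card E1 \<le> card P"
    using E1_finite \<open>E1 \<noteq> {}\<close> E1_P P_finite by (auto simp: Suc_leI card_gt_0_iff card_mono)
  then have "\<lceil>log 2 (real (card E1))\<rceil> \<le> \<lceil>log 2 (real (card P))\<rceil>"
    by (intro ceiling_mono) simp
  then have "(1 + real_of_int \<lceil>log 2 (real (card E1))\<rceil>) * sum weight E2 \<le> c * sum weight E2"
    unfolding c_def by (intro mult_right_mono sum_nonneg weight_nonneg) simp
  then have E1_E2: "sum weight E1 \<le> c * sum weight E2"
    using k unfolding E2_def d0_def by linarith
  \<comment> \<open>The factor \<open>2\<close> comes from the discarded light edges.\<close>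
  define L where "L = 2 * a * b * c"
  have L: "0 < L"
    using a b c by (simp add: L_def)
  have "sum weight P \<le> 2 * b * (c * sum weight E2)"
    using \<omega>0(2) E1_E2 b unfolding E1_def[symmetric]
    by (meson mult_left_mono order_trans mult_nonneg_nonneg zero_le_numeral zero_le_one)
  then have "a * sum weight P \<le> a * (2 * b * (c * sum weight E2))"
    using a by (intro mult_left_mono) auto
  also have "\<dots> = L * sum weight E2"
    by (simp add: L_def)
  finally have mass_E2: "labelled_mass M Bs Ts Y \<le> ennreal (L * sum weight E2)"
    using mass_P by (meson ennreal_leI order_trans)
  have E2_nonneg: "0 \<le> sum weight E2"
    by (intro sum_nonneg weight_nonneg)
  \<comment> \<open>The factor \<open>p\<close> is \<open>1\<close> for the initial selection and the product of the pruning losses later.\<close>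
  have normalise: "ennreal (inverse L * p) * labelled_mass M Bs Ts Y \<le> ennreal (p * sum weight E2)" for p
  proof -
    have "ennreal (inverse L * p) * labelled_mass M Bs Ts Y
        \<le> ennreal (inverse L * p) * ennreal (L * sum weight E2)"
      using mass_E2 by (intro mult_left_mono) auto
    also have "\<dots> = ennreal (inverse L * p * (L * sum weight E2))"
      using L E2_nonneg by (subst ennreal_mult'') auto
    also have "inverse L * p * (L * sum weight E2) = p * sum weight E2"
      using L by simp
    finally show ?thesis .
  qed
  have "E2 \<noteq> {}"
  proof
    assume "E2 = {}"
    then show False
      using mass_E2 assms(9) by simp
  qed
  interpret comparable_edges M Qs Bs Ts Y0 E2 \<omega>0
    using E2_sub \<open>E2 \<noteq> {}\<close> \<omega>0(1) E2_E1 by unfold_locales (auto simp: E1_def)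
  \<comment> \<open>Back from real weights to the extended non-negative weights of the statement.\<close>
  have E2_weight: "0 < edge_weight M Ts Y0 B Q \<and> ennreal \<omega>0 \<le> edge_weight M Ts Y0 B Q \<and>
      edge_weight M Ts Y0 B Q < ennreal (2 * \<omega>0)" if "(B, Q) \<in> E2" for B Q
  proof -
    have "(B, Q) \<in> E1"
      using that E2_E1 by blast
    then have "0 < edge_weight M Ts Y0 B Q" "\<omega>0 \<le> weight (B, Q)" "weight (B, Q) < 2 * \<omega>0"
      by (auto simp: E1_def P_def)
    moreover have "ennreal (weight (B, Q)) = edge_weight M Ts Y0 B Q"
      using that E2_sub by (intro ennreal_weight) auto
    ultimately show ?thesis
      using \<omega>0(1) by (metis ennreal_leI ennreal_lessI less_trans mult_pos_pos zero_less_numeral)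
  qed
  have child_mult: "family_mult (Ts B) (edge_shading E Y0 B) x \<in> {2 ^ k0..<2 * 2 ^ k0}"
    if "x \<in> family_union (Ts B) (edge_shading E Y0 B)" for E B x
    using layer_family_mult[of x Ts B E M Y k0] that by (simp add: Y0_def)
  have parent_mult: "real (family_mult Bs (edge_region E2) x) \<in> {d0..<2 * d0}"
    if "x \<in> family_union Bs (edge_region E2)" for x
    using that E1_P P_sub unfolding E2_def by (intro family_mult_degree_class) auto
  have d0: "0 < d0"
    by (simp add: d0_def)
  \<comment> \<open>Stated for subsets of \<open>E2\<close>, so that it covers every stage of the pruning: over a point there
    are fewer than \<open>2 * d0\<close> parents, each contributing at most \<open>2 * 2 ^ k0\<close>.\<close>
  have total: "real (total_mult Bs Ts (edge_shading E Y0) x) < 4 * real (2 ^ k0) * d0"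
    if "E \<subseteq> E2" for E x
  proof -
    have "family_mult Bs (edge_region E) x \<le> family_mult Bs (edge_region E2) x"
      unfolding family_mult_def using that
      by (intro sum_mono) (auto simp: indicator_def edge_region_def)
    moreover have "real (family_mult Bs (edge_region E2) x) < 2 * d0"
    proof (cases "x \<in> family_union Bs (edge_region E2)")
      case True
      then show ?thesis
        using parent_mult by simp
    next
      case False
      then have "family_mult Bs (edge_region E2) x = 0"
        by (auto simp: family_mult_def family_union_def indicator_def)
      then show ?thesis
        using d0 by simp
    qed
    ultimately have "real (family_mult Bs (edge_region E) x) < 2 * d0"
      by linarith
    then have bound: "2 * real (2 ^ k0) * real (family_mult Bs (edge_region E) x)
        < 2 * real (2 ^ k0) * (2 * d0)"
      by (intro mult_strict_left_mono) auto
    have "total_mult Bs Ts (edge_shading E Y0) x \<le> 2 * 2 ^ k0 * family_mult Bs (edge_region E) x"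
      using child_mult by (rule total_mult_le)
    then have "real (total_mult Bs Ts (edge_shading E Y0) x)
        \<le> 2 * real (2 ^ k0) * real (family_mult Bs (edge_region E) x)"
      by (metis of_nat_le_iff of_nat_mult of_nat_numeral)
    also note bound
    finally show ?thesis by simp
  qed
  have stability: "ennreal (inverse L * (\<Prod>j=1..m. r j / (2 * \<kappa>))) * labelled_mass M Bs Ts Y
        \<le> labelled_mass M Bs Ts (edge_shading (E m) Y0)" and chain: "\<forall>j\<in>{0..m}. E j \<subseteq> E2"
    if "0 < q0" "\<forall>(B, Q)\<in>E2. ennreal q0 \<le> emeasure M Q \<and> emeasure M Q \<le> ennreal (\<kappa> * q0)"
      "E 0 = E2" and nested: "\<forall>j\<in>{1..m}. E j \<subseteq> E (j - 1)"
      and r: "\<forall>j\<in>{1..m}. 0 < r j \<and> r j \<le> 1 \<and>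
        ennreal (r j) * (\<Sum>B\<in>Bs. emeasure M (edge_region (E (j - 1)) B))
          \<le> (\<Sum>B\<in>Bs. emeasure M (edge_region (E j) B))"
    for q0 \<kappa> m and E :: "nat \<Rightarrow> ('b \<times> 'x set) set" and r :: "nat \<Rightarrow> real"
  proof -
    have sub: "E j \<subseteq> E2" if "j \<le> m" for j
      using that
    proof (induction j)
      case 0
      then show ?case using \<open>E 0 = E2\<close> by simp
    next
      case (Suc j)
      then have "E (Suc j) \<subseteq> E j"
        using nested by (metis atLeastAtMost_iff diff_Suc_1 le_add1 plus_1_eq_Suc)
      with Suc show ?case by simp
    qed
    then show "\<forall>j\<in>{0..m}. E j \<subseteq> E2" by simp
    have "(\<Prod>j=1..m. r j / (2 * \<kappa>)) * sum weight E2 \<le> sum weight (E m)"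
      using that(1-3) r sub by (intro pruning_chain[where E = E and ?q0.0 = q0]) auto
    moreover have "labelled_mass M Bs Ts (edge_shading (E m) Y0) = ennreal (sum weight (E m))"
      using sub[of m] E2_sub by (intro labelled_mass_edges) auto
    ultimately show "ennreal (inverse L * (\<Prod>j=1..m. r j / (2 * \<kappa>))) * labelled_mass M Bs Ts Y
        \<le> labelled_mass M Bs Ts (edge_shading (E m) Y0)"
      using order_trans[OF normalise ennreal_leI] by simp
  qed
  have largest: "\<exists>d. largest_degree_class E d" if "E \<subseteq> E2" for E
    using that E2_sub by (intro largest_degree_class_exists finite_edges) auto
  have class_mult: "real (family_mult Bs (edge_region (degree_class_edges E d)) x) \<in> {d..<2 * d}"
    if "E \<subseteq> E2" "x \<in> family_union Bs (edge_region (degree_class_edges E d))" for E d x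
    using that E2_sub by (intro family_mult_degree_class) auto
  have mass: "ennreal (inverse L) * labelled_mass M Bs Ts Y \<le> labelled_mass M Bs Ts (edge_shading E2 Y0)"
    using normalise[of 1] labelled_mass_edges[OF E2_sub] by simp
  have L_le: "L \<le> 4 * a * b * c"
    using a b c by (simp add: L_def)
  have covered: "edge_shading E2 Y0 B T \<subseteq> edge_region E2 B" for B T
    by (auto simp: edge_shading_def)
  have heavy: "edge_region E2 B
      = \<Union>{Q \<in> Qs. 0 < emeasure M (Q \<inter> family_union (Ts B) (edge_shading E2 Y0 B))}" if "B \<in> Bs" for B
    using E2_sub E2_weight that by (intro edge_region_eq_heavy_atoms) auto
  show ?thesis
    unfolding Let_def
  proof (rule exI[of _ k0], rule exI[of _ E2], rule exI[of _ \<omega>0], rule exI[of _ d0],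
      rule exI[of _ L], fold N_def Y0_def, fold P_def, fold a_def b_def c_def,
      intro conjI, goal_cases)
    case 1 show ?case by (rule k0)
  next
    case 2 show ?case by (rule E2_sub)
  next
    case 3 show ?case by (rule \<omega>0(1))
  next
    case 4 show ?case by (rule d0)
  next
    case 5 show ?case using E2_weight by blast
  next
    case 6 show ?case by (rule L)
  next
    case 7 show ?case by (rule L_le)
  next
    case 8 show ?case by (rule mass)
  next
    case 9 show ?case using covered heavy by blast
  next
    case 10 show ?case using child_mult by blast
  next
    case 11 show ?case using parent_mult by blast
  next
    case 12 show ?case using total by blast
  next
    case 13 show ?case
    proof (intro allI impI conjI ballI, goal_cases)
      case (1 q0 \<kappa> m E r)
      then show ?case by (rule stability)
    next
      case (2 q0 \<kappa> m E r j B x)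
      then show ?case by (intro child_mult)
    next
      case (3 q0 \<kappa> m E r j x)
      then show ?case using chain[OF 3(1-5)] by (intro total) blast
    next
      case (4 q0 \<kappa> m E r j)
      then show ?case using chain[OF 4(1-5)] by (intro largest) blast
    next
      case (5 q0 \<kappa> m E r j d x)
      then show ?case using chain[OF 5(1-5)] by (intro class_mult) blast+
    next
      case (6 q0 \<kappa> m E r j d)
      then show ?case using chain[OF 6(1-5)] by (intro degree_class_mass) blast+
    qed
  qed
qed

end
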